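(* Let $N\ge1$ and consider the flow $$\begin{bmatrix}\dot{\boldsymbol m}\\ \dot{\boldsymbol u}\end{bmatrix}=-A^N\begin{bmatrix}\boldsymbol m\\ \boldsymbol u\end{bmatrix}+\begin{bmatrix}\overline H^N(t)\boldsymbol\iota\\ 0\end{bmatrix},$$ with initial data $(\boldsymbol m(0),\boldsymbol u(0))\in\mathbb R_+^N\times\mathbb R^N$, $h\sum_{i=1}^N\boldsymbol m_i(0)=1$, where $\overline H^N(t)\in\mathbb R$ is such that the total mass is preserved, that is, $\sum_{i=1}^N\dot{\boldsymbol m}_i=0$. Then: (a) $\boldsymbol m(t)>0$ (componentwise) for all $t$. (b) $\frac{d}{dt}\sum_{i=1}^N\boldsymbol u_i=0$. (c) If $(\bar m^N,\bar u^N,\overline H^N)\in\mathbb R_+^N\times\mathbb R^N\times\mathbb R$ satisfies $$A^N\begin{bmatrix}\bar m^N\\ \bar u^N\end{bmatrix}=\begin{bmatrix}-\overline H^N\boldsymbol\iota\\ 0\end{bmatrix},\qquad h\sum_{i=1}^N\bar m_i^N=1,$$ then $$\frac{d}{dt}\Big(\|\boldsymbol m-\bar m^N\|^2+\|\boldsymbol u-\bar u^N\|^2\Big)\le0 .$$ (d) If, furthermore, $A^N$ is strictly monotone, then the inequality in (c) is strict if $(\boldsymbol m,\boldsymbol u)\ne(\bar m^N,\bar u^N)$. In this case, $(\boldsymbol m(t),\boldsymbol u(t))$ is globally bounded and converges to $(\bar m^N,\bar u^N)$ as $t\to\infty$, and consequently $\overline H^N(t)$ converges to $-\overline H^N$.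
   Context: $\mathbb T$ is the one-dimensional torus, identified with $[0,1]$, and $V,b:\mathbb T\to\mathbb R$ are given periodic functions. $F:\mathbb R\times\mathbb R\times\mathbb T\to\mathbb R$ is a function, differentiable in $(p,q)$, such that: (1) $F(p,q,x)$ is jointly convex in $(p,q)$; (2) the functions $p\mapsto F(p,q,x)$ for fixed $(q,x)$ and $q\mapsto F(p,q,x)$ for fixed $(p,x)$ are increasing; (3) $F(-p,p,x)=\frac{p^2}{2}+b(x)p+V(x)$; (4) there is a constant $c>0$ such that $F(-p,q,x)+F(q',p,x')\ge-\frac1c+c\,p^2$ for all $p,q,q'\in\mathbb R$ and $x,x'\in\mathbb T$. For $N\ge1$, set $h=\frac1N$ and $x_i=\frac iN$, $i\in\{1,\dots,N\}$. For $u\in\mathbb R^N$ use the periodicity convention $u_0=u_N$, $u_{N+1}=u_1$. Define $G:\mathbb R^N\to\mathbb R^N$ by $G_i(u)=F\big(\frac{u_i-u_{i+1}}h,\frac{u_i-u_{i-1}}h,x_i\big)$. $\mathcal L_u$ is the linearized operator (differential) of $G$ at $u$, and $\mathcal L_u^*$ is its adjoint, i.e. $(\mathcal L_u^*w)_i=\sum_{j=1}^N\frac{\partial G_j}{\partial u_i}(u)\,w_j$. $\mathbb R_+^N$ is the set of vectors with strictly positive entries and $\boldsymbol\iota=(1,\dots,1)\in\mathbb R^N$. The operator $A^N$ is $$A^N\begin{bmatrix}m\\ u\end{bmatrix}=\begin{bmatrix}-G(u)+\ln m\\ \mathcal L_u^*m\end{bmatrix},\qquad (m,u)\in\mathbb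 R_+^N\times\mathbb R^N,$$ with $\ln m=(\ln m_1,\dots,\ln m_N)$. $A^N$ is called strictly monotone if $$\Big\langle A^N\begin{bmatrix}m\\ u\end{bmatrix}-A^N\begin{bmatrix}\theta\\ v\end{bmatrix},\begin{bmatrix}m\\ u\end{bmatrix}-\begin{bmatrix}\theta\\ v\end{bmatrix}\Big\rangle_{\mathbb R^N\times\mathbb R^N}>0$$ whenever $(m,u),(\theta,v)\in\mathbb R_+^N\times\mathbb R^N$ satisfy $v\ne u$ and $\sum_{i=1}^N v_i=\sum_{i=1}^N u_i$. Norms are Euclidean norms on $\mathbb R^N$.
   Formalization: In (d) the condition that the sum of the entries of ū^N equals the sum of the entries of u(0) is added; without it (d) fails, since ū^N is determined only up to an additive constant while the flow conserves the sum of u (e.g. m(0)=m̄^N, u(0)=ū^N+const). *)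

theory Defs
  imports "HOL-Analysis.Analysis"
begin

(* The torus is R/Z: functions on it are functions on the reals of period 1.
   "Increasing" is the non-strict notion: the model example
   F(p,q,x) = max(p,0)^2/2 + max(q,0)^2/2 is not strictly increasing. *)

definition periodic1 :: "(real \<Rightarrow> 'a) \<Rightarrow> bool" where
  "periodic1 f \<longleftrightarrow> (\<forall>x. f (x + 1) = f x)"

definition mfg_hamiltonian ::
  "(real \<Rightarrow> real \<Rightarrow> real \<Rightarrow> real) \<Rightarrow> (real \<Rightarrow> real) \<Rightarrow> (real \<Rightarrow> real) \<Rightarrow> bool" where
  "mfg_hamiltonian F b V \<longleftrightarrow>
     periodic1 b \<and> periodic1 V \<and> (\<forall>p q. periodic1 (F p q)) \<and>
     (\<forall>x w. (\<lambda>z :: real \<times> real. F (fst z) (snd z) x) differentiable (at w)) \<and>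
     (\<forall>x. convex_on UNIV (\<lambda>z :: real \<times> real. F (fst z) (snd z) x)) \<and>
     (\<forall>q x. mono (\<lambda>p. F p q x)) \<and> (\<forall>p x. mono (\<lambda>q. F p q x)) \<and>
     (\<forall>p x. F (- p) p x = p\<^sup>2 / 2 + b x * p + V x) \<and>
     (\<exists>c>0. \<forall>p q q' x x'. F (- p) q x + F q' p x' \<ge> - 1 / c + c * p\<^sup>2)"

(* A vector in R^N is a function nat => real of which only the entries with
   index in {1..N} matter. *)

definition per :: "nat \<Rightarrow> (nat \<Rightarrow> real) \<Rightarrow> nat \<Rightarrow> real" where
  "per N u i = (if i = 0 then u N else if i = N + 1 then u 1 else u i)"

definition G ::
  "(real \<Rightarrow> real \<Rightarrow> real \<Rightarrow> real) \<Rightarrow> nat \<Rightarrow> (nat \<Rightarrow> real) \<Rightarrow> nat \<Rightarrow> real" where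
  "G F N u i = (let h = 1 / real N in
     F ((u i - per N u (i + 1)) / h) ((u i - per N u (i - 1)) / h) (real i / real N))"

definition partial_G ::
  "(real \<Rightarrow> real \<Rightarrow> real \<Rightarrow> real) \<Rightarrow> nat \<Rightarrow> (nat \<Rightarrow> real) \<Rightarrow> nat \<Rightarrow> nat \<Rightarrow> real" where
  "partial_G F N u j i = deriv (\<lambda>s. G F N (u(i := s)) j) (u i)"

definition L_adj ::
  "(real \<Rightarrow> real \<Rightarrow> real \<Rightarrow> real) \<Rightarrow> nat \<Rightarrow> (nat \<Rightarrow> real) \<Rightarrow> (nat \<Rightarrow> real) \<Rightarrow> nat \<Rightarrow> real" where
  "L_adj F N u w i = (\<Sum>j = 1..N. partial_G F N u j i * w j)"

definition pos_vec :: "nat \<Rightarrow> (nat \<Rightarrow> real) \<Rightarrow> bool" where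
  "pos_vec N m \<longleftrightarrow> (\<forall>i\<in>{1..N}. m i > 0)"

definition eq_vec :: "nat \<Rightarrow> (nat \<Rightarrow> real) \<Rightarrow> (nat \<Rightarrow> real) \<Rightarrow> bool" where
  "eq_vec N u v \<longleftrightarrow> (\<forall>i\<in>{1..N}. u i = v i)"

definition A_op ::
  "(real \<Rightarrow> real \<Rightarrow> real \<Rightarrow> real) \<Rightarrow> nat \<Rightarrow>
   (nat \<Rightarrow> real) \<times> (nat \<Rightarrow> real) \<Rightarrow> (nat \<Rightarrow> real) \<times> (nat \<Rightarrow> real)" where
  "A_op F N = (\<lambda>(m, u). (\<lambda>i. - G F N u i + ln (m i), \<lambda>i. L_adj F N u m i))"

definition strictly_monotone_A :: "(real \<Rightarrow> real \<Rightarrow> real \<Rightarrow> real) \<Rightarrow> nat \<Rightarrow> bool" where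
  "strictly_monotone_A F N \<longleftrightarrow>
     (\<forall>m u \<theta> v. pos_vec N m \<longrightarrow> pos_vec N \<theta> \<longrightarrow> \<not> eq_vec N v u \<longrightarrow>
        (\<Sum>i = 1..N. v i) = (\<Sum>i = 1..N. u i) \<longrightarrow>
        (\<Sum>i = 1..N. (fst (A_op F N (m, u)) i - fst (A_op F N (\<theta>, v)) i) * (m i - \<theta> i)) +
        (\<Sum>i = 1..N. (snd (A_op F N (m, u)) i - snd (A_op F N (\<theta>, v)) i) * (u i - v i)) > 0)"

definition time_dom :: "ereal \<Rightarrow> real set" where
  "time_dom T = {t. 0 \<le> t \<and> ereal t < T}"

(* A^N is defined only for positive m, so the flow equation (and the choice of H)
   is imposed only at times where m(t) is positive; this keeps the totalised value
   of ln outside (0, oo) out of the dynamics, and positivity is not presupposed. *)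

definition flow_solution ::
  "(real \<Rightarrow> real \<Rightarrow> real \<Rightarrow> real) \<Rightarrow> nat \<Rightarrow> ereal \<Rightarrow>
   (real \<Rightarrow> nat \<Rightarrow> real) \<Rightarrow> (real \<Rightarrow> nat \<Rightarrow> real) \<Rightarrow> (real \<Rightarrow> real) \<Rightarrow> bool" where
  "flow_solution F N T m u H \<longleftrightarrow>
     (\<forall>i\<in>{1..N}. continuous_on (time_dom T) (\<lambda>s. m s i) \<and>
                 continuous_on (time_dom T) (\<lambda>s. u s i)) \<and>
     (\<forall>t\<in>time_dom T. pos_vec N (m t) \<longrightarrow>
        (\<forall>i\<in>{1..N}.
           ((\<lambda>s. m s i) has_real_derivative - fst (A_op F N (m t, u t)) i + H t)
             (at t within time_dom T) \<and>
           ((\<lambda>s. u s i) has_real_derivative - snd (A_op F N (m t, u t)) i)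
             (at t within time_dom T)) \<and>
        ((\<lambda>s. \<Sum>i = 1..N. m s i) has_real_derivative 0) (at t within time_dom T))"

definition stationary_solution ::
  "(real \<Rightarrow> real \<Rightarrow> real \<Rightarrow> real) \<Rightarrow> nat \<Rightarrow>
   (nat \<Rightarrow> real) \<Rightarrow> (nat \<Rightarrow> real) \<Rightarrow> real \<Rightarrow> bool" where
  "stationary_solution F N mb ub Hb \<longleftrightarrow>
     pos_vec N mb \<and>
     (\<forall>i\<in>{1..N}. fst (A_op F N (mb, ub)) i = - Hb \<and> snd (A_op F N (mb, ub)) i = 0) \<and>
     1 / real N * (\<Sum>i = 1..N. mb i) = 1"

definition dist_sq ::
  "nat \<Rightarrow> (nat \<Rightarrow> real) \<Rightarrow> (nat \<Rightarrow> real) \<Rightarrow> (nat \<Rightarrow> real) \<Rightarrow> (nat \<Rightarrow> real) \<Rightarrow> real" where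
  "dist_sq N m u mb ub =
     (L2_set (\<lambda>i. m i - mb i) {1..N})\<^sup>2 + (L2_set (\<lambda>i. u i - ub i) {1..N})\<^sup>2"

end

theory Submission
  imports Defs "HOL-Complex_Analysis.Great_Picard"
begin

text \<open>
  The squared distance to a stationary solution is a Lyapunov function, and its derivative along
  the flow is \<open>-2 * gap\<close>, where \<open>gap\<close> is the pairing that defines monotonicity of \<open>A\<close>
  (\<open>deriv_dist_sq\<close>). The multiplier \<open>H\<close> does not contribute, since both densities have the same
  mass. By \<open>gap_eq\<close>, the gap is a sum of Bregman remainders of the convex functions \<open>G\<^sub>j\<close>,
  weighted by the two positive densities, and of the terms
  \<open>(ln m - ln \<theta>) * (m - \<theta>)\<close>; hence it is nonnegative. If the two values of \<open>u\<close> agree, then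
  the logarithmic terms make it strictly positive unless the densities agree as well. If they
  differ, strict monotonicity applies once their sums agree, and the flow conserves the sum of
  \<open>u\<close>: invariance of \<open>G\<close> under adding constants to \<open>u\<close> makes the entries of \<open>L\<^sub>u\<^sup>*m\<close> sum to zero.

  Positivity of \<open>m\<close> comes from the logarithm acting as a barrier (\<open>ln_barrier\<close>). Summing the
  equations for \<open>m\<close> shows that \<open>H\<close> is the mean of \<open>ln m\<^sub>j - G\<^sub>j\<close>. Some entry of \<open>m\<close> is at least
  its mean 1, so at a small minimum \<open>\<delta>\<close> of the entries this mean of logarithms exceeds \<open>ln \<delta>\<close> by
  at least \<open>- ln \<delta> / N\<close>, which beats a bound on \<open>G\<close> and pushes the minimal entry up.

  For the convergence, the Lyapunov function is bounded below, so there are times at which the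
  gap tends to zero. At such times the logarithmic terms keep \<open>m\<close> away from zero
  (\<open>gap_lower_bound\<close>), so a subsequence of the bounded trajectory converges to a point with
  \<open>m > 0\<close>. The gap is lower semicontinuous (\<open>gap_limit_le\<close>), because the directional derivatives
  of convex functions are infima of difference quotients. The limit point therefore has gap zero
  and is the stationary solution, and the monotone Lyapunov function tends to zero.
\<close>

section \<open>Directional derivatives and convexity of G\<close>

definition dG ::
  "(real \<Rightarrow> real \<Rightarrow> real \<Rightarrow> real) \<Rightarrow> nat \<Rightarrow> (nat \<Rightarrow> real) \<Rightarrow> nat \<Rightarrow> (nat \<Rightarrow> real) \<Rightarrow> real" where
  "dG F N u j w = (\<Sum>i = 1..N. partial_G F N u j i * w i)"

definition slopes :: "nat \<Rightarrow> nat \<Rightarrow> (nat \<Rightarrow> real) \<Rightarrow> real \<times> real" where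
  "slopes N j w = ((w j - per N w (j + 1)) / (1 / real N), (w j - per N w (j - 1)) / (1 / real N))"

definition F2 :: "(real \<Rightarrow> real \<Rightarrow> real \<Rightarrow> real) \<Rightarrow> real \<Rightarrow> real \<times> real \<Rightarrow> real" where
  "F2 F x z = F (fst z) (snd z) x"

lemma G_eq: "G F N u j = F2 F (real j / real N) (slopes N j u)"
  by (simp add: G_def F2_def slopes_def Let_def)

lemma F2_differentiable: "mfg_hamiltonian F b V \<Longrightarrow> F2 F x differentiable (at z)"
  unfolding mfg_hamiltonian_def F2_def by blast

lemma F2_convex: "mfg_hamiltonian F b V \<Longrightarrow> convex_on UNIV (F2 F x)"
  unfolding mfg_hamiltonian_def F2_def by blast

lemma slopes_line: "slopes N j (\<lambda>i. u i + s * w i) = slopes N j u + s *\<^sub>R slopes N j w"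
  by (simp add: slopes_def per_def field_simps)

text \<open>
  The index shift of \<open>per\<close> maps \<open>{0..N + 1}\<close> to \<open>{1..N}\<close>, so \<open>slopes\<close> depends only on
  the entries that vectors really have, and linearity in these gives the expansion.
\<close>

lemma slopes_expand:
  assumes j: "j \<in> {1..N}"
  shows "slopes N j w = (\<Sum>i = 1..N. w i *\<^sub>R slopes N j (\<lambda>k. if k = i then 1 else 0))"
proof -
  define r where "r k = (if k = 0 then N else if k = N + 1 then 1 else k)" for k
  have per: "per N v k = v (r k)" for v :: "nat \<Rightarrow> real" and k
    by (simp add: per_def r_def)
  have r: "r (j + 1) \<in> {1..N}" "r (j - 1) \<in> {1..N}"
    using j by (auto simp: r_def)
  have delta: "(\<Sum>i = 1..N. w i * (((if j = i then 1 else 0) - (if k = i then 1 else 0)) / h)) =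
      (w j - w k) / h" if "k \<in> {1..N}" for k h
  proof -
    have "(\<Sum>i = 1..N. w i * (((if j = i then 1 else 0) - (if k = i then 1 else 0)) / h)) =
        (\<Sum>i = 1..N. (if j = i then w i else 0) - (if k = i then w i else 0)) / h"
      unfolding sum_divide_distrib by (intro sum.cong) auto
    then show ?thesis
      using j that by (simp add: sum_subtractf)
  qed
  show ?thesis
    unfolding slopes_def per
    by (rule prod_eqI) (simp_all only: fst_sum snd_sum fst_conv snd_conv scaleR_Pair real_scaleR_def delta r)
qed

text \<open>
  Every directional derivative of \<open>G\<close> comes from the derivative of \<open>F\<close> at one point of the plane,
  hence is linear in the direction; applied to the unit vectors this derivative gives the
  numbers \<open>partial_G\<close>.
\<close>

lemma G_has_derivative_line:
  assumes F: "mfg_hamiltonian F b V" and j: "j \<in> {1..N}"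
  shows "((\<lambda>s. G F N (\<lambda>i. u i + s * w i) j) has_real_derivative dG F N u j w) (at 0)"
proof -
  define x where "x = real j / real N"
  obtain D where D: "(F2 F x has_derivative D) (at (slopes N j u))"
    using F2_differentiable[OF F] unfolding differentiable_def by blast
  interpret D: linear D using D by (rule has_derivative_linear)
  have line: "((\<lambda>s. G F N (\<lambda>i. u i + s * w i) j) has_real_derivative D (slopes N j w)) (at 0)" for w
  proof -
    have "((\<lambda>s. slopes N j u + s *\<^sub>R slopes N j w) has_derivative (\<lambda>s. s *\<^sub>R slopes N j w)) (at 0)"
      by (auto intro!: derivative_eq_intros)
    moreover have "(F2 F x has_derivative D) (at (slopes N j u + 0 *\<^sub>R slopes N j w))"
      using D by simp
    ultimately have "((\<lambda>s. F2 F x (slopes N j u + s *\<^sub>R slopes N j w)) has_derivative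
        (\<lambda>s. D (s *\<^sub>R slopes N j w))) (at 0)"
      by (rule has_derivative_compose)
    then show ?thesis
      unfolding has_field_derivative_def G_eq slopes_line x_def[symmetric]
      by (rule has_derivative_eq_rhs) (simp add: fun_eq_iff D.scale)
  qed
  have partial: "partial_G F N u j i = D (slopes N j (\<lambda>k. if k = i then 1 else 0))" for i
  proof -
    let ?e = "\<lambda>k. if k = i then 1 else (0::real)"
    have "((\<lambda>s. G F N (\<lambda>k. u k + (s + - u i) * ?e k) j) has_real_derivative D (slopes N j ?e)) (at (u i))"
      using line[of ?e] DERIV_shift[of "\<lambda>s. G F N (\<lambda>k. u k + s * ?e k) j" "D (slopes N j ?e)" "u i" "- u i"]
      by simp
    moreover have "(\<lambda>k. u k + (s + - u i) * ?e k) = u(i := s)" for s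
      by auto
    ultimately show ?thesis
      unfolding partial_G_def by (simp only: DERIV_imp_deriv)
  qed
  have "D (slopes N j w) = dG F N u j w"
    by (subst slopes_expand[OF j]) (simp add: D.sum D.scale dG_def partial mult.commute)
  then show ?thesis using line[of w] by simp
qed

text \<open>
  Adding a constant to \<open>u\<close> changes no slope.
\<close>

lemma dG_const:
  assumes F: "mfg_hamiltonian F b V" and j: "j \<in> {1..N}"
  shows "dG F N u j (\<lambda>_. 1) = 0"
proof -
  have "slopes N j (\<lambda>_. 1) = 0" by (simp add: slopes_def per_def zero_prod_def)
  then have "(\<lambda>s. G F N (\<lambda>i. u i + s * 1) j) = (\<lambda>s. G F N u j)"
    by (simp only: G_eq slopes_line) simp
  then show ?thesis
    using G_has_derivative_line[OF F j, of u "\<lambda>_. 1"] by (metis DERIV_const DERIV_unique)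
qed

lemma sum_L_adj_times:
  "(\<Sum>i = 1..N. L_adj F N u m i * w i) = (\<Sum>j = 1..N. m j * dG F N u j w)"
  unfolding L_adj_def dG_def sum_distrib_left sum_distrib_right
  by (subst sum.swap) (simp add: algebra_simps)

lemma sum_L_adj:
  assumes "mfg_hamiltonian F b V"
  shows "(\<Sum>i = 1..N. L_adj F N u m i) = 0"
  using sum_L_adj_times[of F N u m "\<lambda>_. 1"] dG_const[OF assms] by simp

lemma dG_uminus: "dG F N u j (\<lambda>i. v i - w i) = - dG F N u j (\<lambda>i. w i - v i)"
  by (simp add: dG_def algebra_simps flip: sum_negf sum_subtractf)

lemma G_above_tangent:
  assumes F: "mfg_hamiltonian F b V" and j: "j \<in> {1..N}"
  shows "G F N u j + dG F N u j w \<le> G F N (\<lambda>i. u i + w i) j"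
proof -
  let ?g = "\<lambda>s. G F N (\<lambda>i. u i + s * w i) j"
  have "convex_on UNIV ?g"
  proof (rule convex_onI)
    fix t x y :: real assume t: "0 < t" "t < 1"
    have *: "slopes N j u + ((1 - t) * x + t * y) *\<^sub>R slopes N j w =
        (1 - t) *\<^sub>R (slopes N j u + x *\<^sub>R slopes N j w) + t *\<^sub>R (slopes N j u + y *\<^sub>R slopes N j w)"
      by (simp add: algebra_simps)
    show "?g ((1 - t) *\<^sub>R x + t *\<^sub>R y) \<le> (1 - t) * ?g x + t * ?g y"
      unfolding G_eq slopes_line real_scaleR_def *
      using t by (intro convex_onD[OF F2_convex[OF F]]) auto
  qed auto
  moreover have "(?g has_real_derivative dG F N u j w) (at 0)"
    by (rule G_has_derivative_line[OF F j])
  ultimately have "?g 1 - ?g 0 \<ge> dG F N u j w * (1 - 0)"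
    by (intro convex_on_imp_above_tangent[where A = UNIV]) auto
  then show ?thesis by simp
qed

lemma tendsto_G:
  assumes F: "mfg_hamiltonian F b V" and j: "j \<in> {1..N}"
    and lim: "\<And>i. i \<in> {1..N} \<Longrightarrow> ((\<lambda>t. u t i) \<longlongrightarrow> v i) A"
  shows "((\<lambda>t. G F N (u t) j) \<longlongrightarrow> G F N v j) A"
proof -
  have per: "((\<lambda>t. per N (u t) k) \<longlongrightarrow> per N v k) A" if "k \<le> N + 1" for k
    using that lim j by (auto simp: per_def)
  have "((\<lambda>t. slopes N j (u t)) \<longlongrightarrow> slopes N j v) A"
    unfolding slopes_def using j
    by (intro tendsto_Pair tendsto_divide tendsto_diff per lim tendsto_const) auto
  moreover have "isCont (F2 F (real j / real N)) (slopes N j v)"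
    by (intro differentiable_imp_continuous_within F2_differentiable[OF F])
  ultimately show ?thesis
    unfolding G_eq by (rule isCont_tendsto_compose[rotated])
qed

section \<open>Monotonicity of A\<close>

text \<open>
  The pairing whose positivity is the monotonicity of \<open>A\<close>.
\<close>

definition gap ::
  "(real \<Rightarrow> real \<Rightarrow> real \<Rightarrow> real) \<Rightarrow> nat \<Rightarrow> (nat \<Rightarrow> real) \<Rightarrow> (nat \<Rightarrow> real) \<Rightarrow>
   (nat \<Rightarrow> real) \<Rightarrow> (nat \<Rightarrow> real) \<Rightarrow> real" where
  "gap F N m u \<theta> v =
     (\<Sum>i = 1..N. (fst (A_op F N (m, u)) i - fst (A_op F N (\<theta>, v)) i) * (m i - \<theta> i)) +
     (\<Sum>i = 1..N. (snd (A_op F N (m, u)) i - snd (A_op F N (\<theta>, v)) i) * (u i - v i))"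

text \<open>
  The key identity. Moving \<open>L\<^sub>u\<^sup>*\<close> to the other side of the pairing turns the second component of
  \<open>A\<close> into derivatives of \<open>G\<close> along \<open>u - v\<close>; collecting the coefficients of \<open>m\<close> and of \<open>\<theta>\<close>
  leaves the errors of the tangent approximations of \<open>G\<close> at \<open>u\<close> and at \<open>v\<close>.
\<close>

lemma gap_eq:
  "gap F N m u \<theta> v =
     (\<Sum>j = 1..N. m j * (G F N v j - G F N u j - dG F N u j (\<lambda>i. v i - u i))) +
     (\<Sum>j = 1..N. \<theta> j * (G F N u j - G F N v j - dG F N v j (\<lambda>i. u i - v i))) +
     (\<Sum>j = 1..N. (ln (m j) - ln (\<theta> j)) * (m j - \<theta> j))"
proof -
  let ?a = "\<lambda>j. (G F N v j - G F N u j + (ln (m j) - ln (\<theta> j))) * (m j - \<theta> j)"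
  let ?b = "\<lambda>j. m j * dG F N u j (\<lambda>i. u i - v i)"
  let ?c = "\<lambda>j. \<theta> j * dG F N v j (\<lambda>i. u i - v i)"
  have "(\<Sum>i = 1..N. (L_adj F N u m i - L_adj F N v \<theta> i) * (u i - v i)) = sum ?b {1..N} - sum ?c {1..N}"
    using sum_L_adj_times[of F N u m "\<lambda>i. u i - v i"] sum_L_adj_times[of F N v \<theta> "\<lambda>i. u i - v i"]
    by (simp add: left_diff_distrib sum_subtractf)
  moreover have "(\<Sum>i = 1..N. (fst (A_op F N (m, u)) i - fst (A_op F N (\<theta>, v)) i) * (m i - \<theta> i)) = sum ?a {1..N}"
    by (intro sum.cong) (auto simp: A_op_def)
  ultimately have "gap F N m u \<theta> v = sum ?a {1..N} + (sum ?b {1..N} - sum ?c {1..N})"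
    by (simp add: gap_def A_op_def)
  also have "\<dots> = (\<Sum>j = 1..N. ?a j + (?b j - ?c j))"
    by (simp add: sum.distrib sum_subtractf)
  also have "\<dots> = (\<Sum>j = 1..N. m j * (G F N v j - G F N u j - dG F N u j (\<lambda>i. v i - u i)) +
      \<theta> j * (G F N u j - G F N v j - dG F N v j (\<lambda>i. u i - v i)) +
      (ln (m j) - ln (\<theta> j)) * (m j - \<theta> j))"
  proof (intro sum.cong refl)
    fix j
    have "dG F N u j (\<lambda>i. u i - v i) = - dG F N u j (\<lambda>i. v i - u i)" by (rule dG_uminus)
    then show "?a j + (?b j - ?c j) = m j * (G F N v j - G F N u j - dG F N u j (\<lambda>i. v i - u i)) +
      \<theta> j * (G F N u j - G F N v j - dG F N v j (\<lambda>i. u i - v i)) +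
      (ln (m j) - ln (\<theta> j)) * (m j - \<theta> j)"
      by (simp add: algebra_simps)
  qed
  finally show ?thesis by (simp add: sum.distrib)
qed

lemma G_bregman_nonneg:
  assumes "mfg_hamiltonian F b V" "j \<in> {1..N}"
  shows "0 \<le> G F N v j - G F N u j - dG F N u j (\<lambda>i. v i - u i)"
  using G_above_tangent[OF assms, of u "\<lambda>i. v i - u i"] by simp

lemma ln_diff_mult_pos:
  fixes x y :: real
  assumes "x > 0" "y > 0"
  shows "0 \<le> (ln x - ln y) * (x - y)" and "x \<noteq> y \<Longrightarrow> 0 < (ln x - ln y) * (x - y)"
proof -
  show *: "0 < (ln x - ln y) * (x - y)" if "x \<noteq> y"
    using assms that by (cases x y rule: linorder_cases) (auto intro: mult_pos_pos mult_neg_neg)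
  show "0 \<le> (ln x - ln y) * (x - y)"
    using * by (cases "x = y") auto
qed

lemma gap_ge_ln_part:
  assumes F: "mfg_hamiltonian F b V" and m: "pos_vec N m" and \<theta>: "pos_vec N \<theta>"
  shows "gap F N m u \<theta> v \<ge> (\<Sum>j = 1..N. (ln (m j) - ln (\<theta> j)) * (m j - \<theta> j))"
proof -
  have bregman: "0 \<le> p j * (G F N y j - G F N x j - dG F N x j (\<lambda>i. y i - x i))"
    if "pos_vec N p" "j \<in> {1..N}" for p x y j
    using G_bregman_nonneg[OF F that(2)] that unfolding pos_vec_def by (simp add: less_imp_le)
  have "(\<Sum>j = 1..N. m j * (G F N v j - G F N u j - dG F N u j (\<lambda>i. v i - u i))) \<ge> 0"
    and "(\<Sum>j = 1..N. \<theta> j * (G F N u j - G F N v j - dG F N v j (\<lambda>i. u i - v i))) \<ge> 0"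
    by (intro sum_nonneg bregman m \<theta>; assumption)+
  then show ?thesis by (simp add: gap_eq)
qed

lemma gap_nonneg:
  assumes "mfg_hamiltonian F b V" "pos_vec N m" "pos_vec N \<theta>"
  shows "0 \<le> gap F N m u \<theta> v"
proof -
  have "0 \<le> (\<Sum>j = 1..N. (ln (m j) - ln (\<theta> j)) * (m j - \<theta> j))"
    using assms(2,3) unfolding pos_vec_def by (intro sum_nonneg ln_diff_mult_pos) auto
  then show ?thesis using gap_ge_ln_part[OF assms] by (rule order_trans)
qed

lemma gap_pos:
  assumes F: "mfg_hamiltonian F b V" and m: "pos_vec N m" and \<theta>: "pos_vec N \<theta>"
    and strict: "strictly_monotone_A F N"
    and sums: "(\<Sum>i = 1..N. v i) = (\<Sum>i = 1..N. u i)"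
    and neq: "\<not> (eq_vec N m \<theta> \<and> eq_vec N u v)"
  shows "0 < gap F N m u \<theta> v"
proof (cases "eq_vec N u v")
  case False
  then have "\<not> eq_vec N v u" unfolding eq_vec_def by metis
  then show ?thesis
    using strict m \<theta> sums unfolding strictly_monotone_A_def gap_def by blast
next
  case True
  then obtain k where k: "k \<in> {1..N}" "m k \<noteq> \<theta> k" using neq by (auto simp: eq_vec_def)
  have "0 < (\<Sum>j = 1..N. (ln (m j) - ln (\<theta> j)) * (m j - \<theta> j))"
    using k m \<theta> unfolding pos_vec_def
    by (intro sum_pos2[of _ k] ln_diff_mult_pos) auto
  then show ?thesis using gap_ge_ln_part[OF F m \<theta>] by (rule less_le_trans)
qed

lemma dG_le_quotient:
  assumes F: "mfg_hamiltonian F b V" and j: "j \<in> {1..N}" and s: "s > 0"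
  shows "dG F N u j w \<le> (G F N (\<lambda>i. u i + s * w i) j - G F N u j) / s"
proof -
  have "dG F N u j (\<lambda>i. s * w i) = s * dG F N u j w"
    by (simp add: dG_def sum_distrib_left algebra_simps)
  then show ?thesis
    using G_above_tangent[OF F j, of u "\<lambda>i. s * w i"] s by (simp add: field_simps)
qed

text \<open>
  Lower semicontinuity of the gap in its first two arguments. Every term of \<open>gap_eq\<close> other
  than the derivative of \<open>G\<close> at the varying point \<open>u\<close> is continuous by inspection. Bounding this
  derivative from above by a difference quotient gives a continuous minorant of the gap for each step \<open>s > 0\<close>; these minorants pass to
  the limit, and letting \<open>s\<close> tend to 0 afterwards recovers the gap.
\<close>

lemma gap_limit_le:
  assumes F: "mfg_hamiltonian F b V"
    and pos: "\<And>k. pos_vec N (m k)" and m': "pos_vec N m'" and \<theta>: "pos_vec N \<theta>"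
    and lim: "\<And>i. i \<in> {1..N} \<Longrightarrow> (\<lambda>k. m k i) \<longlonglongrightarrow> m' i"
      "\<And>i. i \<in> {1..N} \<Longrightarrow> (\<lambda>k. u k i) \<longlonglongrightarrow> u' i"
    and le: "\<And>k. gap F N (m k) (u k) \<theta> v \<le> a k" and a: "a \<longlonglongrightarrow> c"
  shows "gap F N m' u' \<theta> v \<le> c"
proof -
  define lower where "lower s m u =
     (\<Sum>j = 1..N. m j * (G F N v j - G F N u j - (G F N (\<lambda>i. u i + s * (v i - u i)) j - G F N u j) / s)) +
     (\<Sum>j = 1..N. \<theta> j * (G F N u j - G F N v j - dG F N v j (\<lambda>i. u i - v i))) +
     (\<Sum>j = 1..N. (ln (m j) - ln (\<theta> j)) * (m j - \<theta> j))" for s m u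
  have lower_le: "lower s m u \<le> gap F N m u \<theta> v" if "s > 0" "pos_vec N m" for s m u
    unfolding gap_eq lower_def using that(2)
    by (intro add_right_mono sum_mono mult_left_mono diff_left_mono dG_le_quotient[OF F _ that(1)])
      (auto simp: pos_vec_def less_imp_le)
  have lower_c: "lower s m' u' \<le> c" if s: "s > 0" for s
  proof (rule LIMSEQ_le)
    have "m' j > 0" "\<theta> j > 0" if "j \<in> {1..N}" for j
      using that m' \<theta> by (auto simp: pos_vec_def)
    then show "(\<lambda>k. lower s (m k) (u k)) \<longlonglongrightarrow> lower s m' u'"
      unfolding lower_def dG_def using s
      by (intro tendsto_intros tendsto_G[OF F] lim) (auto simp: less_imp_neq[symmetric])
    show "\<exists>M. \<forall>k\<ge>M. lower s (m k) (u k) \<le> a k"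
      using lower_le[OF s pos] le order_trans by blast
  qed (rule a)
  have quotient: "((\<lambda>s. (G F N (\<lambda>i. u' i + s * w i) j - G F N u' j) / s) \<longlongrightarrow> dG F N u' j w) (at_right 0)"
    if "j \<in> {1..N}" for w j
    using G_has_derivative_line[OF F that, of u' w]
    by (auto simp: DERIV_def intro: filterlim_at_split[THEN iffD1, THEN conjunct2])
  have "((\<lambda>s. lower s m' u') \<longlongrightarrow> gap F N m' u' \<theta> v) (at_right 0)"
    unfolding lower_def gap_eq
    by (intro tendsto_add tendsto_sum tendsto_mult tendsto_diff tendsto_const quotient) auto
  then show ?thesis
    by (rule tendsto_upperbound) (auto simp: eventually_at_filter lower_c)
qed

text \<open>
  The gap controls each term \<open>(ln m - ln \<theta>) * (m - \<theta>)\<close>, which blows up as \<open>m\<close> tends to 0 for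
  fixed \<open>\<theta>\<close>: below \<open>\<theta> / 2\<close>, a value at most 1 forces \<open>ln \<theta> - ln m \<le> 2 / \<theta>\<close>.
\<close>

lemma gap_lower_bound:
  assumes F: "mfg_hamiltonian F b V" and m: "pos_vec N m" and \<theta>: "pos_vec N \<theta>"
    and gap: "gap F N m u \<theta> v \<le> 1" and j: "j \<in> {1..N}"
  shows "min (\<theta> j / 2) (\<theta> j * exp (- 2 / \<theta> j)) \<le> m j"
proof (cases "m j \<ge> \<theta> j / 2")
  case False
  have pos: "m j > 0" "\<theta> j > 0" using m \<theta> j by (auto simp: pos_vec_def)
  have "(ln (m j) - ln (\<theta> j)) * (m j - \<theta> j) \<le> (\<Sum>j = 1..N. (ln (m j) - ln (\<theta> j)) * (m j - \<theta> j))"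
    using j m \<theta> unfolding pos_vec_def by (intro member_le_sum ln_diff_mult_pos) auto
  then have "(ln (m j) - ln (\<theta> j)) * (m j - \<theta> j) \<le> 1"
    using gap_ge_ln_part[OF F m \<theta>, of u v] gap by linarith
  moreover have "(ln (\<theta> j) - ln (m j)) * (\<theta> j / 2) \<le> (ln (\<theta> j) - ln (m j)) * (\<theta> j - m j)"
    using False pos by (intro mult_left_mono) auto
  ultimately have "(ln (\<theta> j) - ln (m j)) * (\<theta> j / 2) \<le> 1"
    by (simp add: algebra_simps)
  then have "ln (\<theta> j) + - 2 / \<theta> j \<le> ln (m j)"
    using pos by (simp add: field_simps)
  then have "exp (ln (\<theta> j) + - 2 / \<theta> j) \<le> m j"
    using pos by (simp add: ln_ge_iff)
  then show ?thesis using pos by (simp only: exp_add exp_ln)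
qed simp

section \<open>Mass conservation and positivity\<close>

locale mfg_flow =
  fixes F :: "real \<Rightarrow> real \<Rightarrow> real \<Rightarrow> real" and b V :: "real \<Rightarrow> real"
    and N :: nat and T :: ereal
    and m u :: "real \<Rightarrow> nat \<Rightarrow> real" and H :: "real \<Rightarrow> real"
  assumes ham: "mfg_hamiltonian F b V"
    and N: "N \<ge> 1"
    and flow: "flow_solution F N T m u H"
    and pos0: "pos_vec N (m 0)"
    and mass0: "(\<Sum>i = 1..N. m 0 i) = real N"
begin

lemma time_dom_interval: "t \<in> time_dom T \<Longrightarrow> {0..t} \<subseteq> time_dom T"
  by (auto simp: time_dom_def) (metis ereal_less_eq(3) le_less_trans)

lemma at_within_time_dom_neq_bot:
  assumes "t \<in> time_dom T"
  shows "at t within time_dom T \<noteq> bot"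
proof -
  have "\<exists>s>t. s \<in> time_dom T"
  proof -
    have "ereal t < T" using assms by (simp add: time_dom_def)
    then obtain s where "ereal t < ereal s" "ereal s < T"
      using ereal_dense2 by blast
    then show ?thesis using assms by (auto simp: time_dom_def)
  qed
  then obtain s where s: "s > t" "s \<in> time_dom T" by blast
  have "t \<ge> 0" using assms by (simp add: time_dom_def)
  then have "{t..s} \<subseteq> {0..s}" by auto
  then have "{t..s} \<subseteq> time_dom T"
    using time_dom_interval[OF s(2)] by blast
  moreover have "at t within {t..s} \<noteq> bot"
    using s by (simp add: at_within_Icc_at_right)
  ultimately show ?thesis
    by (metis at_le bot.extremum_uniqueI)
qed

lemma continuous_m: "i \<in> {1..N} \<Longrightarrow> continuous_on (time_dom T) (\<lambda>s. m s i)"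
  and continuous_u: "i \<in> {1..N} \<Longrightarrow> continuous_on (time_dom T) (\<lambda>s. u s i)"
  using flow unfolding flow_solution_def by blast+

lemma deriv_m:
  assumes "t \<in> time_dom T" "pos_vec N (m t)" "i \<in> {1..N}"
  shows "((\<lambda>s. m s i) has_real_derivative G F N (u t) i - ln (m t i) + H t) (at t within time_dom T)"
  using flow assms unfolding flow_solution_def A_op_def by simp

lemma deriv_u:
  assumes "t \<in> time_dom T" "pos_vec N (m t)" "i \<in> {1..N}"
  shows "((\<lambda>s. u s i) has_real_derivative - L_adj F N (u t) (m t) i) (at t within time_dom T)"
  using flow assms unfolding flow_solution_def A_op_def by simp

lemma deriv_mass:
  assumes "t \<in> time_dom T" "pos_vec N (m t)"
  shows "((\<lambda>s. \<Sum>i = 1..N. m s i) has_real_derivative 0) (at t within time_dom T)"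
  using flow assms unfolding flow_solution_def by simp

text \<open>
  Conservation of mass determines the multiplier.
\<close>

lemma H_eq:
  assumes t: "t \<in> time_dom T" and pos: "pos_vec N (m t)"
  shows "real N * H t = (\<Sum>j = 1..N. ln (m t j) - G F N (u t) j)"
proof -
  have "((\<lambda>s. \<Sum>i = 1..N. m s i) has_real_derivative
      (\<Sum>i = 1..N. G F N (u t) i - ln (m t i) + H t)) (at t within time_dom T)"
    by (intro DERIV_sum deriv_m[OF t pos])
  then have "(\<Sum>i = 1..N. G F N (u t) i - ln (m t i) + H t) = 0"
    using deriv_mass[OF t pos] at_within_time_dom_neq_bot[OF t] by (rule has_field_derivative_unique)
  then show ?thesis
    by (simp add: sum.distrib sum_subtractf)
qed

lemma zero_derivative_imp_const:
  assumes t: "t \<in> time_dom T"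
    and deriv: "\<And>s. s \<in> {0..t} \<Longrightarrow> (f has_real_derivative 0) (at s within time_dom T)"
  shows "f t = f 0"
proof -
  have "\<exists>c. \<forall>s\<in>{0..t}. f s = c"
    using DERIV_subset[OF deriv time_dom_interval[OF t]]
    by (intro has_field_derivative_zero_constant) auto
  moreover have "0 \<in> {0..t}" "t \<in> {0..t}" using t by (auto simp: time_dom_def)
  ultimately show ?thesis by metis
qed

lemma mass_conserved:
  assumes t: "t \<in> time_dom T" and pos: "\<And>s. s \<in> {0..t} \<Longrightarrow> pos_vec N (m s)"
  shows "(\<Sum>i = 1..N. m t i) = real N"
proof -
  have "(\<Sum>i = 1..N. m t i) = (\<Sum>i = 1..N. m 0 i)"
    by (intro zero_derivative_imp_const[OF t] deriv_mass pos) (use time_dom_interval[OF t] in auto)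
  then show ?thesis using mass0 by simp
qed

text \<open>
  At the first time \<open>\<tau>\<close> at which some entry \<open>k\<close> has fallen to \<open>\<delta>\<close>, this entry is minimal and
  equal to \<open>\<delta>\<close>. All entries are still positive, so the flow equation holds at \<open>\<tau>\<close> and gives a
  derivative of at least \<open>- ln \<delta> / N - 2 * C > 0\<close>; but then the entry was below \<open>\<delta>\<close> before \<open>\<tau>\<close>.
  Only the flow on \<open>[0, \<tau>]\<close> is used, where positivity is known.
\<close>

lemma ln_barrier:
  assumes t1: "t1 \<in> time_dom T"
    and C: "\<And>s j. s \<in> {0..t1} \<Longrightarrow> j \<in> {1..N} \<Longrightarrow> \<bar>G F N (u s) j\<bar> \<le> C"
    and \<delta>: "\<delta> > 0" "ln \<delta> < - 2 * C * real N" "\<And>i. i \<in> {1..N} \<Longrightarrow> \<delta> < m 0 i"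
    and si: "s \<in> {0..t1}" "i \<in> {1..N}"
  shows "\<delta> < m s i"
proof (rule ccontr)
  assume contra: "\<not> \<delta> < m s i"
  define B where "B = (\<Union>i\<in>{1..N}. {s \<in> {0..t1}. m s i \<le> \<delta>})"
  have cont: "continuous_on {0..t} (\<lambda>s. m s i)" if "i \<in> {1..N}" "t \<in> {0..t1}" for i t
    by (rule continuous_on_subset[OF continuous_on_subset[OF continuous_m[OF that(1)] time_dom_interval[OF t1]]])
      (use that(2) in auto)
  have "closed B"
    unfolding B_def using t1
    by (intro closed_UN ballI continuous_on_closed_Collect_le cont continuous_on_const)
      (auto simp: time_dom_def)
  moreover have "B \<subseteq> {0..t1}" by (auto simp: B_def)
  ultimately have "compact B" using compact_Int_closed[of "{0..t1}" B] by (simp add: Int_absorb1)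
  moreover have "B \<noteq> {}" using contra si by (force simp: B_def)
  ultimately obtain \<tau> where \<tau>: "\<tau> \<in> B" "\<And>s. s \<in> B \<Longrightarrow> \<tau> \<le> s"
    using compact_attains_inf by metis
  from \<tau>(1) obtain k where k: "k \<in> {1..N}" "m \<tau> k \<le> \<delta>" and \<tau>01: "\<tau> \<in> {0..t1}"
    by (auto simp: B_def)
  have \<tau>dom: "\<tau> \<in> time_dom T" using \<tau>01 time_dom_interval[OF t1] by blast
  have "\<tau> \<noteq> 0" using k \<delta>(3) by force
  then have "\<tau> > 0" using \<tau>01 by simp
  have before: "\<delta> < m s j" if "0 \<le> s" "s < \<tau>" "j \<in> {1..N}" for s j
  proof (rule ccontr)
    assume "\<not> \<delta> < m s j"
    then have "s \<in> B" using that \<tau>01 unfolding B_def by force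
    then show False using \<tau>(2) that by force
  qed
  have at: "\<delta> \<le> m \<tau> j" if j: "j \<in> {1..N}" for j
  proof (rule ccontr)
    assume less: "\<not> \<delta> \<le> m \<tau> j"
    then obtain r where r: "0 \<le> r" "r \<le> \<tau>" "m r j = \<delta>"
      using IVT2'[of "\<lambda>s. m s j" \<tau> \<delta> 0] \<delta>(3)[OF j] cont[OF j \<tau>01] \<open>\<tau> > 0\<close> by force
    then have "r < \<tau>" using less by (cases "r = \<tau>") auto
    then show False using before[of r j] r j by simp
  qed
  have pos: "pos_vec N (m s)" if "s \<in> {0..\<tau>}" for s
  proof (cases "s = \<tau>")
    case True
    then show ?thesis using at \<delta>(1) by (force simp: pos_vec_def)
  next
    case False
    then show ?thesis using before[of s] that \<delta>(1) by (force simp: pos_vec_def)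
  qed
  have pos\<tau>: "pos_vec N (m \<tau>)" using pos \<open>\<tau> > 0\<close> by simp
  have mk: "m \<tau> k = \<delta>" using k at by force
  \<comment> \<open>Since the mean of the entries is 1, some entry is at least 1.\<close>
  have "\<exists>l\<in>{1..N}. 1 \<le> m \<tau> l"
  proof (rule ccontr)
    assume "\<not> ?thesis"
    then have "(\<Sum>i = 1..N. m \<tau> i) < (\<Sum>i = 1..N. 1)"
      using N by (intro sum_strict_mono) (auto simp: not_le)
    then show False using mass_conserved[OF \<tau>dom pos] by simp
  qed
  then obtain l where l: "l \<in> {1..N}" "1 \<le> m \<tau> l" by blast
  \<comment> \<open>The other entries are at least \<open>\<delta>\<close>, which bounds \<open>H\<close> from below.\<close>
  have "(\<Sum>j \<in> {1..N} - {l}. ln \<delta>) \<le> (\<Sum>j \<in> {1..N} - {l}. ln (m \<tau> j))"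
    using at \<delta>(1) by (intro sum_mono) (meson DiffD1 ln_mono order_less_le_trans)
  moreover have "0 \<le> ln (m \<tau> l)" using l by simp
  moreover have "(\<Sum>j = 1..N. ln (m \<tau> j)) = ln (m \<tau> l) + (\<Sum>j \<in> {1..N} - {l}. ln (m \<tau> j))"
    using l(1) by (intro sum.remove) auto
  ultimately have "(real N - 1) * ln \<delta> \<le> (\<Sum>j = 1..N. ln (m \<tau> j))"
    using l(1) N by (simp add: of_nat_diff)
  moreover have "(\<Sum>j = 1..N. G F N (u \<tau>) j) \<le> (\<Sum>j = 1..N. C)"
    using C[OF \<tau>01] by (intro sum_mono) (force simp: abs_le_iff)
  ultimately have NH: "(real N - 1) * ln \<delta> - real N * C \<le> real N * H \<tau>"
    using H_eq[OF \<tau>dom pos\<tau>] by (simp add: sum_subtractf)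
  have "real N * (G F N (u \<tau>) k) \<ge> real N * (- C)"
    using C[OF \<tau>01 k(1)] by (intro mult_left_mono) (auto simp: abs_le_iff)
  then have "0 < real N * (G F N (u \<tau>) k - ln (m \<tau> k) + H \<tau>)"
    using NH \<delta>(2) unfolding mk by (simp add: algebra_simps)
  then have "0 < G F N (u \<tau>) k - ln (m \<tau> k) + H \<tau>"
    using N by (simp add: zero_less_mult_iff)
  from has_real_derivative_pos_inc_left[OF deriv_m[OF \<tau>dom pos\<tau> k(1)] this]
  obtain d where d: "d > 0" "\<And>h. h > 0 \<Longrightarrow> \<tau> - h \<in> time_dom T \<Longrightarrow> h < d \<Longrightarrow> m (\<tau> - h) k < m \<tau> k"
    by blast
  define h where "h = min (d / 2) \<tau>"
  have h: "h > 0" "h < d" "\<tau> - h \<ge> 0" "\<tau> - h < \<tau>"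
    using d(1) \<open>\<tau> > 0\<close> by (auto simp: h_def)
  then have "\<tau> - h \<in> time_dom T" using time_dom_interval[OF \<tau>dom] by auto
  then have "m (\<tau> - h) k < \<delta>" using d(2)[of h] h mk by simp
  then show False using before[of "\<tau> - h" k] h k(1) by simp
qed

lemma barrier_exists:
  obtains \<delta> where "\<delta> > 0" "ln \<delta> < - 2 * C * real N" "\<And>i. i \<in> {1..N} \<Longrightarrow> \<delta> < m 0 i"
proof -
  define \<mu> where "\<mu> = Min (m 0 ` {1..N})"
  have "\<mu> \<in> m 0 ` {1..N}" unfolding \<mu>_def using N by (intro Min_in) auto
  then have "\<mu> > 0" using pos0 by (auto simp: pos_vec_def)
  have \<mu>: "\<mu> \<le> m 0 i" if "i \<in> {1..N}" for i
    unfolding \<mu>_def using that by (intro Min_le) auto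
  define \<delta> where "\<delta> = min (\<mu> / 2) (exp (- 2 * C * real N - 1))"
  have "\<delta> > 0" using \<open>\<mu> > 0\<close> by (simp add: \<delta>_def)
  moreover have "ln \<delta> < - 2 * C * real N"
  proof -
    have "ln \<delta> \<le> ln (exp (- 2 * C * real N - 1))"
      using \<open>\<delta> > 0\<close> by (intro ln_mono) (auto simp: \<delta>_def)
    then show ?thesis by simp
  qed
  moreover have "\<delta> < m 0 i" if "i \<in> {1..N}" for i
    using \<mu>[OF that] \<open>\<mu> > 0\<close> by (auto simp: \<delta>_def)
  ultimately show thesis using that by blast
qed

lemma positive:
  assumes t: "t \<in> time_dom T"
  shows "pos_vec N (m t)"
proof -
  have "\<exists>B. \<forall>s\<in>{0..t}. \<bar>G F N (u s) j\<bar> \<le> B" if j: "j \<in> {1..N}" for j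
  proof -
    have "continuous_on {0..t} (\<lambda>s. G F N (u s) j)"
      unfolding continuous_on
    proof
      fix s assume s: "s \<in> {0..t}"
      have "((\<lambda>s. u s i) \<longlongrightarrow> u s i) (at s within {0..t})" if "i \<in> {1..N}" for i
        using continuous_on_subset[OF continuous_u[OF that] time_dom_interval[OF t]] s
        unfolding continuous_on by blast
      then show "((\<lambda>s. G F N (u s) j) \<longlongrightarrow> G F N (u s) j) (at s within {0..t})"
        by (rule tendsto_G[OF ham j])
    qed
    then have "compact ((\<lambda>s. G F N (u s) j) ` {0..t})"
      by (intro compact_continuous_image) auto
    then show ?thesis
      using compact_imp_bounded bounded_iff by (metis image_eqI real_norm_def)
  qed
  then obtain B where B: "\<And>j s. j \<in> {1..N} \<Longrightarrow> s \<in> {0..t} \<Longrightarrow> \<bar>G F N (u s) j\<bar> \<le> B j"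
    by metis
  have BC: "\<bar>G F N (u s) j\<bar> \<le> Max (B ` {1..N})" if "s \<in> {0..t}" "j \<in> {1..N}" for s j
    proof -
    have "B j \<le> Max (B ` {1..N})" using that(2) by (intro Max_ge) auto
    then show ?thesis using B[OF that(2,1)] by linarith
  qed
  obtain \<delta> where \<delta>: "\<delta> > 0" "ln \<delta> < - 2 * Max (B ` {1..N}) * real N"
    "\<And>i. i \<in> {1..N} \<Longrightarrow> \<delta> < m 0 i"
    using barrier_exists[of "Max (B ` {1..N})"] by blast
  have "\<delta> < m t i" if "i \<in> {1..N}" for i
    using ln_barrier[OF t BC \<delta> _ that, of t] t by (simp add: time_dom_def)
  then show ?thesis using \<delta>(1) by (force simp: pos_vec_def)
qed

lemma mass: "t \<in> time_dom T \<Longrightarrow> (\<Sum>i = 1..N. m t i) = real N"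
  using mass_conserved positive time_dom_interval by blast

lemma deriv_sum_u:
  assumes "t \<in> time_dom T"
  shows "((\<lambda>s. \<Sum>i = 1..N. u s i) has_real_derivative 0) (at t within time_dom T)"
proof -
  have "((\<lambda>s. \<Sum>i = 1..N. u s i) has_real_derivative (\<Sum>i = 1..N. - L_adj F N (u t) (m t) i))
      (at t within time_dom T)"
    by (intro DERIV_sum deriv_u[OF assms positive[OF assms]])
  then show ?thesis by (simp only: sum_negf sum_L_adj[OF ham] minus_zero)
qed

lemma sum_u:
  assumes t: "t \<in> time_dom T"
  shows "(\<Sum>i = 1..N. u t i) = (\<Sum>i = 1..N. u 0 i)"
  by (intro zero_derivative_imp_const[OF t] deriv_sum_u) (use time_dom_interval[OF t] in auto)

end

section \<open>The Lyapunov function and convergence\<close>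

lemma dist_sq_eq: "dist_sq N m u mb ub = (\<Sum>i = 1..N. (m i - mb i)\<^sup>2) + (\<Sum>i = 1..N. (u i - ub i)\<^sup>2)"
  by (simp add: dist_sq_def L2_set_def sum_nonneg)

lemma dist_sq_nonneg: "0 \<le> dist_sq N m u mb ub"
  by (simp add: dist_sq_def)

lemma component_le_dist_sq:
  assumes "i \<in> {1..N}"
  shows "\<bar>m i - mb i\<bar> \<le> sqrt (dist_sq N m u mb ub)" "\<bar>u i - ub i\<bar> \<le> sqrt (dist_sq N m u mb ub)"
proof -
  have le: "(w i - wb i)\<^sup>2 \<le> (\<Sum>i = 1..N. (w i - wb i)\<^sup>2)" for w wb :: "nat \<Rightarrow> real"
    using assms by (intro member_le_sum) auto
  have nonneg: "0 \<le> (\<Sum>i = 1..N. (w i - wb i)\<^sup>2)" for w wb :: "nat \<Rightarrow> real"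
    by (intro sum_nonneg) auto
  have "(m i - mb i)\<^sup>2 \<le> dist_sq N m u mb ub" "(u i - ub i)\<^sup>2 \<le> dist_sq N m u mb ub"
    unfolding dist_sq_eq using le[of m mb] nonneg[of u ub] le[of u ub] nonneg[of m mb] by linarith+
  then show "\<bar>m i - mb i\<bar> \<le> sqrt (dist_sq N m u mb ub)" "\<bar>u i - ub i\<bar> \<le> sqrt (dist_sq N m u mb ub)"
    by (simp_all add: real_le_rsqrt)
qed

lemma derivative_le_imp_diff_le:
  fixes f :: "real \<Rightarrow> real"
  assumes ab: "a \<le> b" "{a..b} \<subseteq> S"
    and deriv: "\<And>x. x \<in> {a..b} \<Longrightarrow> \<exists>D\<le>c. (f has_real_derivative D) (at x within S)"
  shows "f b - f a \<le> c * (b - a)"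
proof (cases "a = b")
  case False
  then have "a < b" using ab by simp
  obtain D where D: "\<And>x. x \<in> {a..b} \<Longrightarrow> D x \<le> c \<and> (f has_real_derivative D x) (at x within S)"
    using deriv by metis
  have "(f has_derivative (*) (D x)) (at x within {a..b})" if "a \<le> x" "x \<le> b" for x
    using D[of x] that ab(2) has_field_derivative_subset unfolding has_field_derivative_def[symmetric]
    by (metis atLeastAtMost_iff)
  then obtain x where "x \<in> {a<..<b}" "f b - f a = D x * (b - a)"
    using mvt_simple[OF \<open>a < b\<close>, of f "\<lambda>x. (*) (D x)"] by blast
  then show ?thesis
    using D[of x] \<open>a < b\<close> by (simp add: mult_right_mono)
qed auto

context mfg_flow
begin

text \<open>
  The stationary equations allow the values of \<open>A\<close> at \<open>(mb, ub)\<close> to be subtracted: this changes the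
  sums only by a multiple of \<open>\<Sum> (m - mb) = 0\<close>, as does the multiplier \<open>H\<close>.
\<close>

lemma deriv_dist_sq:
  assumes stat: "stationary_solution F N mb ub Hb" and t: "t \<in> time_dom T"
  shows "((\<lambda>s. dist_sq N (m s) (u s) mb ub) has_real_derivative
    - 2 * gap F N (m t) (u t) mb ub) (at t within time_dom T)"
proof -
  let ?A1 = "fst (A_op F N (m t, u t))" and ?A2 = "snd (A_op F N (m t, u t))"
  have A1: "fst (A_op F N (mb, ub)) i = - Hb" and A2: "snd (A_op F N (mb, ub)) i = 0"
    if "i \<in> {1..N}" for i
    using stat that by (auto simp: stationary_solution_def)
  have "(\<Sum>i = 1..N. mb i) = real N"
    using stat N by (simp add: stationary_solution_def)
  then have mass_eq: "(\<Sum>i = 1..N. m t i - mb i) = 0"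
    using mass[OF t] by (simp add: sum_subtractf)
  have dm: "((\<lambda>s. m s i) has_real_derivative - ?A1 i + H t) (at t within time_dom T)"
    and du: "((\<lambda>s. u s i) has_real_derivative - ?A2 i) (at t within time_dom T)"
    if "i \<in> {1..N}" for i
    using flow t positive[OF t] that unfolding flow_solution_def by blast+
  have "((\<lambda>s. \<Sum>i = 1..N. (m s i - mb i)\<^sup>2) has_real_derivative
      (\<Sum>i = 1..N. 2 * (m t i - mb i) * (- ?A1 i + H t))) (at t within time_dom T)"
    by (intro DERIV_sum) (auto intro!: derivative_eq_intros dm)
  moreover have "((\<lambda>s. \<Sum>i = 1..N. (u s i - ub i)\<^sup>2) has_real_derivative
      (\<Sum>i = 1..N. 2 * (u t i - ub i) * (- ?A2 i))) (at t within time_dom T)"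
    by (intro DERIV_sum) (auto intro!: derivative_eq_intros du)
  ultimately have "((\<lambda>s. dist_sq N (m s) (u s) mb ub) has_real_derivative
      (\<Sum>i = 1..N. 2 * (m t i - mb i) * (- ?A1 i + H t)) + (\<Sum>i = 1..N. 2 * (u t i - ub i) * (- ?A2 i)))
      (at t within time_dom T)"
    unfolding dist_sq_eq by (rule DERIV_add)
  moreover have "(\<Sum>i = 1..N. 2 * (m t i - mb i) * (- ?A1 i + H t)) =
      - 2 * (\<Sum>i = 1..N. (?A1 i - fst (A_op F N (mb, ub)) i) * (m t i - mb i))"
  proof -
    have "(\<Sum>i = 1..N. 2 * (m t i - mb i) * (- ?A1 i + H t)) =
        (\<Sum>i = 1..N. - 2 * ((?A1 i - fst (A_op F N (mb, ub)) i) * (m t i - mb i)) +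
          2 * (H t + Hb) * (m t i - mb i))"
      by (intro sum.cong refl) (simp add: A1 algebra_simps)
    also have "\<dots> = - 2 * (\<Sum>i = 1..N. (?A1 i - fst (A_op F N (mb, ub)) i) * (m t i - mb i)) +
        2 * (H t + Hb) * (\<Sum>i = 1..N. m t i - mb i)"
      by (simp only: sum.distrib sum_distrib_left)
    finally show ?thesis unfolding mass_eq by simp
  qed
  moreover have "(\<Sum>i = 1..N. 2 * (u t i - ub i) * (- ?A2 i)) =
      - 2 * (\<Sum>i = 1..N. (?A2 i - snd (A_op F N (mb, ub)) i) * (u t i - ub i))"
    unfolding sum_distrib_left by (intro sum.cong refl) (simp add: A2 algebra_simps)
  ultimately show ?thesis
    by (simp add: gap_def algebra_simps)
qed

lemma gap_nonneg_flow:
  assumes "stationary_solution F N mb ub Hb" "t \<in> time_dom T"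
  shows "0 \<le> gap F N (m t) (u t) mb ub"
  using assms by (intro gap_nonneg[OF ham] positive) (auto simp: stationary_solution_def)

lemma dist_sq_antimono:
  assumes stat: "stationary_solution F N mb ub Hb" and st: "0 \<le> s" "s \<le> t" "t \<in> time_dom T"
  shows "dist_sq N (m t) (u t) mb ub \<le> dist_sq N (m s) (u s) mb ub"
proof -
  have sub: "{s..t} \<subseteq> time_dom T"
    using time_dom_interval[OF st(3)] st(1) by force
  have "dist_sq N (m t) (u t) mb ub - dist_sq N (m s) (u s) mb ub \<le> 0 * (t - s)"
  proof (rule derivative_le_imp_diff_le[OF st(2) sub])
    fix r assume "r \<in> {s..t}"
    then have r: "r \<in> time_dom T" using sub by blast
    show "\<exists>D\<le>0. ((\<lambda>s. dist_sq N (m s) (u s) mb ub) has_real_derivative D) (at r within time_dom T)"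
      using deriv_dist_sq[OF stat r] gap_nonneg_flow[OF stat r]
      by (intro exI[of _ "- 2 * gap F N (m r) (u r) mb ub"]) simp
  qed
  then show ?thesis by simp
qed

lemma bounded_flow:
  assumes stat: "stationary_solution F N mb ub Hb"
  obtains K where "\<And>t i. t \<in> time_dom T \<Longrightarrow> i \<in> {1..N} \<Longrightarrow> \<bar>m t i\<bar> \<le> K"
    "\<And>t i. t \<in> time_dom T \<Longrightarrow> i \<in> {1..N} \<Longrightarrow> \<bar>u t i\<bar> \<le> K"
proof -
  define R where "R = sqrt (dist_sq N (m 0) (u 0) mb ub)"
  define K where "K = R + (\<Sum>i = 1..N. \<bar>mb i\<bar> + \<bar>ub i\<bar>)"
  have "\<bar>m t i\<bar> \<le> K \<and> \<bar>u t i\<bar> \<le> K" if t: "t \<in> time_dom T" and i: "i \<in> {1..N}" for t i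
  proof -
    have "sqrt (dist_sq N (m t) (u t) mb ub) \<le> R"
      unfolding R_def using dist_sq_antimono[OF stat _ _ t, of 0] t by (simp add: time_dom_def)
    moreover have "\<bar>mb i\<bar> + \<bar>ub i\<bar> \<le> (\<Sum>i = 1..N. \<bar>mb i\<bar> + \<bar>ub i\<bar>)"
      using i by (intro member_le_sum) auto
    ultimately show ?thesis
      using component_le_dist_sq(1)[OF i, of "m t" mb "u t" ub]
        component_le_dist_sq(2)[OF i, of "u t" ub "m t" mb] unfolding K_def by linarith
  qed
  then show thesis using that by blast
qed

text \<open>
  Otherwise the squared distance, which is nonnegative, would decrease at least at rate \<open>2 * c\<close>
  forever.
\<close>

lemma small_gap_times:
  assumes stat: "stationary_solution F N mb ub Hb" and Tinf: "T = \<infinity>" and c: "c > 0"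
  shows "\<exists>t\<ge>0. gap F N (m t) (u t) mb ub \<le> c"
proof (rule ccontr)
  assume "\<not> ?thesis"
  then have gap: "gap F N (m t) (u t) mb ub > c" if "t \<ge> 0" for t using that by force
  have dom: "time_dom T = {0..}" by (auto simp: Tinf time_dom_def)
  let ?E = "\<lambda>t. dist_sq N (m t) (u t) mb ub"
  \<comment> \<open>At this time the squared distance would be at most \<open>-1\<close>.\<close>
  define t where "t = (?E 0 + 1) / (2 * c)"
  have t: "t \<ge> 0" using dist_sq_nonneg[of N "m 0" "u 0" mb ub] c by (simp add: t_def)
  have "?E t - ?E 0 \<le> - 2 * c * (t - 0)"
  proof (rule derivative_le_imp_diff_le[where S = "time_dom T"])
    fix s assume "s \<in> {0..t}"
    then show "\<exists>D\<le>- 2 * c. (?E has_real_derivative D) (at s within time_dom T)"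
      using deriv_dist_sq[OF stat, of s] gap[of s] dom
      by (intro exI[of _ "- 2 * gap F N (m s) (u s) mb ub"]) auto
  qed (use t dom in auto)
  also have "\<dots> = - (?E 0 + 1)" using c by (simp add: t_def)
  finally show False using dist_sq_nonneg[of N "m t" "u t" mb ub] by simp
qed

text \<open>
  If the squared distance stayed above \<open>\<eta>\<close>, the trajectory along times with vanishing gap would
  accumulate at a point of gap at most 0 at squared distance at least \<open>\<eta>\<close> from the stationary
  solution, contradicting the strict positivity of the gap.
\<close>

lemma dist_sq_gets_small:
  assumes stat: "stationary_solution F N mb ub Hb" and Tinf: "T = \<infinity>"
    and strict: "strictly_monotone_A F N" and sums: "(\<Sum>i = 1..N. ub i) = (\<Sum>i = 1..N. u 0 i)"
    and \<eta>: "\<eta> > 0"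
  shows "\<exists>t\<ge>0. dist_sq N (m t) (u t) mb ub < \<eta>"
proof (rule ccontr)
  assume "\<not> ?thesis"
  then have large: "dist_sq N (m t) (u t) mb ub \<ge> \<eta>" if "t \<ge> 0" for t using that by force
  have dom: "t \<in> time_dom T \<longleftrightarrow> t \<ge> 0" for t by (auto simp: Tinf time_dom_def)
  have mb: "pos_vec N mb" using stat by (simp add: stationary_solution_def)
  have "\<exists>t\<ge>0. gap F N (m t) (u t) mb ub \<le> 1 / real (Suc k)" for k
    by (intro small_gap_times[OF stat Tinf]) simp
  then obtain \<tau> where \<tau>: "\<And>k. \<tau> k \<ge> 0" "\<And>k. gap F N (m (\<tau> k)) (u (\<tau> k)) mb ub \<le> 1 / real (Suc k)"
    by metis
  obtain K where K: "\<And>t i. t \<in> time_dom T \<Longrightarrow> i \<in> {1..N} \<Longrightarrow> \<bar>m t i\<bar> \<le> K"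
    "\<And>t i. t \<in> time_dom T \<Longrightarrow> i \<in> {1..N} \<Longrightarrow> \<bar>u t i\<bar> \<le> K"
    using bounded_flow[OF stat] by blast
  \<comment> \<open>A Boolean tag joins both components into one family, so that one extraction serves both.\<close>
  define x where "x = (\<lambda>k (i, c). if c then m (\<tau> k) i else u (\<tau> k) i)"
  obtain r where r: "strict_mono (r :: nat \<Rightarrow> nat)"
    "\<And>p. p \<in> {1..N} \<times> (UNIV :: bool set) \<Longrightarrow> \<exists>l. (\<lambda>k. x (r k) p) \<longlonglongrightarrow> l"
  proof (rule function_convergent_subsequence[of "{1..N} \<times> (UNIV :: bool set)" x K])
    show "norm (x k p) \<le> K" if "p \<in> {1..N} \<times> UNIV" for k p
      using that K \<tau>(1) by (auto simp: x_def dom)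
  qed auto
  have "\<forall>i\<in>{1..N}. \<exists>l. (\<lambda>k. m (\<tau> (r k)) i) \<longlonglongrightarrow> l" "\<forall>i\<in>{1..N}. \<exists>l. (\<lambda>k. u (\<tau> (r k)) i) \<longlonglongrightarrow> l"
    using r(2)[of "(_, True)"] r(2)[of "(_, False)"] by (auto simp: x_def)
  then obtain m' u' where lim: "\<And>i. i \<in> {1..N} \<Longrightarrow> (\<lambda>k. m (\<tau> (r k)) i) \<longlonglongrightarrow> m' i"
    "\<And>i. i \<in> {1..N} \<Longrightarrow> (\<lambda>k. u (\<tau> (r k)) i) \<longlonglongrightarrow> u' i"
    by metis
  have pos: "pos_vec N (m (\<tau> k))" for k using positive \<tau>(1) dom by blast
  have m': "pos_vec N m'"
    unfolding pos_vec_def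
  proof
    fix i assume i: "i \<in> {1..N}"
    have "gap F N (m (\<tau> k)) (u (\<tau> k)) mb ub \<le> 1" for k
      using \<tau>(2)[of k] by (rule order_trans) simp
    then have "min (mb i / 2) (mb i * exp (- 2 / mb i)) \<le> m (\<tau> (r k)) i" for k
      using gap_lower_bound[OF ham pos mb _ i] by blast
    then have "min (mb i / 2) (mb i * exp (- 2 / mb i)) \<le> m' i"
      using LIMSEQ_le_const[OF lim(1)[OF i]] by blast
    moreover have "mb i > 0" using mb i by (auto simp: pos_vec_def)
    then have "0 < min (mb i / 2) (mb i * exp (- 2 / mb i))" by simp
    ultimately show "0 < m' i" by linarith
  qed
  have "(\<lambda>k. 1 / real (Suc (r k))) \<longlonglongrightarrow> 0"
    using LIMSEQ_subseq_LIMSEQ[OF LIMSEQ_Suc[OF lim_1_over_n] r(1)] by (simp add: o_def)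
  then have "gap F N m' u' mb ub \<le> 0"
    by (intro gap_limit_le[OF ham pos m' mb lim \<tau>(2)])
  moreover have "0 < gap F N m' u' mb ub"
  proof (rule gap_pos[OF ham m' mb strict])
    have "(\<lambda>k. \<Sum>i = 1..N. u (\<tau> (r k)) i) \<longlonglongrightarrow> (\<Sum>i = 1..N. u' i)"
      by (intro tendsto_sum lim)
    moreover have "(\<Sum>i = 1..N. u (\<tau> (r k)) i) = (\<Sum>i = 1..N. ub i)" for k
      using sum_u \<tau>(1) dom sums by metis
    ultimately show "(\<Sum>i = 1..N. ub i) = (\<Sum>i = 1..N. u' i)"
      using LIMSEQ_unique[OF _ tendsto_const] by force
    have "(\<lambda>k. dist_sq N (m (\<tau> (r k))) (u (\<tau> (r k))) mb ub) \<longlonglongrightarrow> dist_sq N m' u' mb ub"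
      unfolding dist_sq_eq by (intro tendsto_intros lim)
    then have "\<eta> \<le> dist_sq N m' u' mb ub"
      using large[OF \<tau>(1)] by (intro LIMSEQ_le_const) auto
    moreover have "dist_sq N m' u' mb ub = 0" if "eq_vec N m' mb \<and> eq_vec N u' ub"
      using that by (simp add: dist_sq_eq eq_vec_def)
    ultimately show "\<not> (eq_vec N m' mb \<and> eq_vec N u' ub)"
      using \<eta> by linarith
  qed
  ultimately show False by simp
qed

lemma flow_converges:
  assumes stat: "stationary_solution F N mb ub Hb" and Tinf: "T = \<infinity>"
    and strict: "strictly_monotone_A F N" and sums: "(\<Sum>i = 1..N. ub i) = (\<Sum>i = 1..N. u 0 i)"
    and i: "i \<in> {1..N}"
  shows "((\<lambda>t. m t i) \<longlongrightarrow> mb i) at_top" "((\<lambda>t. u t i) \<longlongrightarrow> ub i) at_top"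
proof -
  let ?E = "\<lambda>t. dist_sq N (m t) (u t) mb ub"
  have "(?E \<longlongrightarrow> 0) at_top"
  proof (rule tendstoI)
    fix \<eta> :: real assume "\<eta> > 0"
    then obtain t0 where t0: "t0 \<ge> 0" "?E t0 < \<eta>"
      using dist_sq_gets_small[OF stat Tinf strict sums] by blast
    have "dist (?E t) 0 < \<eta>" if "t \<ge> t0" for t
      using dist_sq_antimono[OF stat t0(1) that] t0 that dist_sq_nonneg[of N "m t" "u t" mb ub]
      by (simp add: Tinf time_dom_def)
    then show "\<forall>\<^sub>F t in at_top. dist (?E t) 0 < \<eta>"
      by (auto simp: eventually_at_top_linorder)
  qed
  then have E: "((\<lambda>t. sqrt (?E t)) \<longlongrightarrow> 0) at_top"
    using tendsto_real_sqrt by fastforce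
  have "((\<lambda>t. m t i - mb i) \<longlongrightarrow> 0) at_top" "((\<lambda>t. u t i - ub i) \<longlongrightarrow> 0) at_top"
    using component_le_dist_sq[OF i] by (auto intro!: Lim_null_comparison[OF _ E] always_eventually)
  then show "((\<lambda>t. m t i) \<longlongrightarrow> mb i) at_top" "((\<lambda>t. u t i) \<longlongrightarrow> ub i) at_top"
    by (simp_all add: LIM_zero_iff)
qed

lemma H_converges:
  assumes stat: "stationary_solution F N mb ub Hb" and Tinf: "T = \<infinity>"
    and strict: "strictly_monotone_A F N" and sums: "(\<Sum>i = 1..N. ub i) = (\<Sum>i = 1..N. u 0 i)"
  shows "(H \<longlongrightarrow> - Hb) at_top"
proof -
  let ?h = "\<lambda>m u. (\<Sum>j = 1..N. ln (m j) - G F N u j) / real N"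
  have mb: "mb j > 0" "ln (mb j) - G F N ub j = - Hb" if "j \<in> {1..N}" for j
    using stat that by (auto simp: stationary_solution_def pos_vec_def A_op_def)
  have lim: "((\<lambda>t. ?h (m t) (u t)) \<longlongrightarrow> ?h mb ub) at_top"
    by (intro tendsto_divide tendsto_sum tendsto_diff tendsto_ln tendsto_const tendsto_G[OF ham]
        flow_converges[OF stat Tinf strict sums]) (use mb(1) N in force)+
  have limit_value: "?h mb ub = - Hb"
    using mb(2) N by simp
  have "\<forall>\<^sub>F t in at_top. ?h (m t) (u t) = H t"
    using eventually_ge_at_top[of 0]
  proof eventually_elim
    case (elim t)
    then have "t \<in> time_dom T" by (simp add: Tinf time_dom_def)
    then show ?case using H_eq[OF _ positive] N by (simp add: field_simps)
  qed
  from Lim_transform_eventually[OF lim this] show ?thesis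
    unfolding limit_value .
qed

end

theorem mainTheorem3:
  fixes F :: "real \<Rightarrow> real \<Rightarrow> real \<Rightarrow> real" and b V :: "real \<Rightarrow> real"
    and N :: nat and T :: ereal
    and m u :: "real \<Rightarrow> nat \<Rightarrow> real" and H :: "real \<Rightarrow> real"
  assumes "mfg_hamiltonian F b V"
    and "N \<ge> 1"
    and "0 < T"
    and "flow_solution F N T m u H"
    and "pos_vec N (m 0)"
    and "1 / real N * (\<Sum>i = 1..N. m 0 i) = 1"
  shows
    "(\<forall>t\<in>time_dom T. pos_vec N (m t)) \<and>
     (\<forall>t\<in>time_dom T.
        ((\<lambda>s. \<Sum>i = 1..N. u s i) has_real_derivative 0) (at t within time_dom T)) \<and>
     (\<forall>mb ub Hb. stationary_solution F N mb ub Hb \<longrightarrow>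
        (\<forall>t\<in>time_dom T. \<exists>D\<le>0.
           ((\<lambda>s. dist_sq N (m s) (u s) mb ub) has_real_derivative D) (at t within time_dom T)) \<and>
        (strictly_monotone_A F N \<and> (\<Sum>i = 1..N. ub i) = (\<Sum>i = 1..N. u 0 i) \<longrightarrow>
           (\<forall>t\<in>time_dom T. \<not> (eq_vec N (m t) mb \<and> eq_vec N (u t) ub) \<longrightarrow>
              (\<exists>D<0. ((\<lambda>s. dist_sq N (m s) (u s) mb ub) has_real_derivative D)
                (at t within time_dom T))) \<and>
           (\<exists>B. \<forall>t\<in>time_dom T.
              L2_set (m t) {1..N} \<le> B \<and> L2_set (u t) {1..N} \<le> B) \<and>
           (T = \<infinity> \<longrightarrow>
              (\<forall>i\<in>{1..N}. ((\<lambda>t. m t i) \<longlongrightarrow> mb i) at_top \<and>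
                          ((\<lambda>t. u t i) \<longlongrightarrow> ub i) at_top) \<and>
              (H \<longlongrightarrow> - Hb) at_top)))"
proof -
  interpret mfg_flow F b V N T m u H
    using assms by unfold_locales simp_all
  have decay: "\<exists>D\<le>0. ((\<lambda>s. dist_sq N (m s) (u s) mb ub) has_real_derivative D) (at t within time_dom T)"
    if "stationary_solution F N mb ub Hb" "t \<in> time_dom T" for mb ub Hb t
    using deriv_dist_sq[OF that] gap_nonneg_flow[OF that]
    by (intro exI[of _ "- 2 * gap F N (m t) (u t) mb ub"]) simp
  have strict_decay: "\<exists>D<0. ((\<lambda>s. dist_sq N (m s) (u s) mb ub) has_real_derivative D) (at t within time_dom T)"
    if stat: "stationary_solution F N mb ub Hb" and t: "t \<in> time_dom T"
      and strict: "strictly_monotone_A F N" and sums: "(\<Sum>i = 1..N. ub i) = (\<Sum>i = 1..N. u 0 i)"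
      and neq: "\<not> (eq_vec N (m t) mb \<and> eq_vec N (u t) ub)" for mb ub Hb t
  proof -
    have "pos_vec N mb" using stat by (simp add: stationary_solution_def)
    then have "0 < gap F N (m t) (u t) mb ub"
      using sums sum_u[OF t] by (intro gap_pos[OF ham positive[OF t] _ strict _ neq]) simp_all
    then show ?thesis
      using deriv_dist_sq[OF stat t] by (intro exI[of _ "- 2 * gap F N (m t) (u t) mb ub"]) simp
  qed
  have bounded: "\<exists>B. \<forall>t\<in>time_dom T. L2_set (m t) {1..N} \<le> B \<and> L2_set (u t) {1..N} \<le> B"
    if stat: "stationary_solution F N mb ub Hb" for mb ub Hb
  proof -
    obtain K where K: "\<And>t i. t \<in> time_dom T \<Longrightarrow> i \<in> {1..N} \<Longrightarrow> \<bar>m t i\<bar> \<le> K"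
      "\<And>t i. t \<in> time_dom T \<Longrightarrow> i \<in> {1..N} \<Longrightarrow> \<bar>u t i\<bar> \<le> K"
      using bounded_flow[OF stat] by blast
    have "L2_set w {1..N} \<le> (\<Sum>i = 1..N. K)" if "\<And>i. i \<in> {1..N} \<Longrightarrow> \<bar>w i\<bar> \<le> K" for w
      using L2_set_le_sum_abs sum_mono[OF that] by (rule order_trans)
    then show ?thesis using K by blast
  qed
  show ?thesis
    by (intro conjI allI ballI impI; (elim conjE)?;
        (rule positive deriv_sum_u | rule decay | rule strict_decay | rule bounded
          | rule flow_converges | rule H_converges); assumption)
qed

end
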